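(* Let $S$ be a finite set and let $p\notin S$. Let $\mathrm{Pointedmat}(S,p)$ be the set of pointed matroids $(M,p)$ on $S\cup\{p\}$ such that $p$ is not a loop of $M$. There are one-to-one correspondences between $\mathrm{Semimat}(S)$, $\mathrm{MatId}(S)$, $\mathrm{MatPreim}(S)$, $\mathrm{MatCoext}(S,p)$ and $\mathrm{Pointedmat}(S,p)$, where: - $\mathrm{Semimat}(S)$ is the set of semimatroids on $S$; - $\mathrm{MatId}(S)$ is the set of pairs $(M,\mathcal{I})$ of a matroid $M$ on $S$ and a modular ideal $\mathcal{I}$ of $M$; - $\mathrm{MatPreim}(S)$ is the set of pairs $(M,N)$ of a matroid $M$ on $S$ and one of its elementary preimages $N$; - $\mathrm{MatCoext}(S,p)$ is the set of pairs $(M,\widetilde{N})$, where $M$ is a matroid on $S$ and $\widetilde{N}$ is one of its rank-increasing single-element coextensions by $p$.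
   Context: $\mathbb{N}$ includes $0$. A simplicial complex on a finite set $S$ is a family of subsets of $S$ closed under taking subsets; singletons need not belong to it. A semimatroid (on $S$) is a triple $(S,\mathcal{C},r_{\mathcal{C}})$ consisting of a finite set $S$, a non-empty simplicial complex $\mathcal{C}$ on $S$, and a function $r_{\mathcal{C}}:\mathcal{C}\to\mathbb{N}$ such that: (R1) if $X\in\mathcal{C}$ then $0\le r_{\mathcal{C}}(X)\le |X|$; (R2) if $X,Y\in\mathcal{C}$ and $X\subseteq Y$ then $r_{\mathcal{C}}(X)\le r_{\mathcal{C}}(Y)$; (R3) if $X,Y\in\mathcal{C}$ and $X\cup Y\in\mathcal{C}$ then $r_{\mathcal{C}}(X)+r_{\mathcal{C}}(Y)\ge r_{\mathcal{C}}(X\cup Y)+r_{\mathcal{C}}(X\cap Y)$; (CR1) if $X,Y\in\mathcal{C}$ and $r_{\mathcal{C}}(X)=r_{\mathcal{C}}(X\cap Y)$ then $X\cup Y\in\mathcal{C}$; (CR2) if $X,Y\in\mathcal{C}$ and $r_{\mathcal{C}}(X)<r_{\mathcal{C}}(Y)$ then $X\cup\{y\}\in\mathcal{C}$ for some $y\in Y-X$. Matroids have finite ground sets; $r_M$ is the rank function of a matroid $M$ and $r(M)$ its rank. A modular ideal $\mathcal{I}$ of a matroid $M$ on $S$ is a non-empty collection of subsets of $S$ such that: (MI1) $\mathcal{I}$ is a simplicial complex; (MI2) $\{a\}\in\mathcal{I}$ for every non-loop $a$ of $M$; (MI3) if $X,Y\in\mathcal{I}$ and $\{X,Y\}$ is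 a modular pair in $M$, i.e. $r_M(X)+r_M(Y)=r_M(X\cup Y)+r_M(X\cap Y)$, then $X\cup Y\in\mathcal{I}$. A quotient map $N\to M$ is a pair of matroids $M,N$ on the same ground set such that every flat of $M$ is a flat of $N$; it is elementary if $r(N)-r(M)$ is $0$ or $1$. An elementary preimage of $M$ is a matroid $N$ on the same ground set such that $N\to M$ is an elementary quotient map. For a matroid $M$ on $S$ and $p\notin S$, a single-element coextension of $M$ by $p$ is a matroid $\widetilde{N}$ on $S\cup\{p\}$ with $M=\widetilde{N}/p$ (contraction of $p$); it is rank-increasing if $r(\widetilde{N})>r(M)$. A pointed matroid is a pair $(M,p)$ of a matroid $M$ and a distinguished element $p$ of its ground set. *)

theory Defs
  imports Main "HOL-Library.FuncSet"
begin

(* Set functions are extensional (the value outside their domain is the fixed dummy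
   "undefined"), so that HOL equality of the structures below is equality of the
   mathematical objects, and the sets at the end of this theory contain no duplicates. *)

definition simplicial_complex :: "'a set \<Rightarrow> 'a set set \<Rightarrow> bool" where
  "simplicial_complex S \<C> \<longleftrightarrow> \<C> \<subseteq> Pow S \<and> (\<forall>X\<in>\<C>. \<forall>Y. Y \<subseteq> X \<longrightarrow> Y \<in> \<C>)"

datatype 'a semimatroid =
  Semimatroid (sm_ground: "'a set") (sm_complex: "'a set set") (sm_rank: "'a set \<Rightarrow> nat")

definition is_semimatroid :: "'a semimatroid \<Rightarrow> bool" where
  "is_semimatroid D \<longleftrightarrow>
    (let S = sm_ground D; \<C> = sm_complex D; r = sm_rank D in
      finite S \<and>
      simplicial_complex S \<C> \<and>
      \<C> \<noteq> {} \<and>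
      r \<in> \<C> \<rightarrow>\<^sub>E UNIV \<and>
      (\<forall>X\<in>\<C>. 0 \<le> r X \<and> r X \<le> card X) \<and>
      (\<forall>X\<in>\<C>. \<forall>Y\<in>\<C>. X \<subseteq> Y \<longrightarrow> r X \<le> r Y) \<and>
      (\<forall>X\<in>\<C>. \<forall>Y\<in>\<C>. X \<union> Y \<in> \<C> \<longrightarrow> r X + r Y \<ge> r (X \<union> Y) + r (X \<inter> Y)) \<and>
      (\<forall>X\<in>\<C>. \<forall>Y\<in>\<C>. r X = r (X \<inter> Y) \<longrightarrow> X \<union> Y \<in> \<C>) \<and>
      (\<forall>X\<in>\<C>. \<forall>Y\<in>\<C>. r X < r Y \<longrightarrow> (\<exists>y\<in>Y - X. X \<union> {y} \<in> \<C>)))"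

(* The rank axioms: a matroid is a semimatroid whose complex is the full power set. *)
datatype 'a matroid = Matroid (ground: "'a set") (rk: "'a set \<Rightarrow> nat")

definition is_matroid :: "'a matroid \<Rightarrow> bool" where
  "is_matroid M \<longleftrightarrow>
    (let S = ground M; r = rk M in
      finite S \<and>
      r \<in> Pow S \<rightarrow>\<^sub>E UNIV \<and>
      (\<forall>X. X \<subseteq> S \<longrightarrow> 0 \<le> r X \<and> r X \<le> card X) \<and>
      (\<forall>X Y. X \<subseteq> Y \<and> Y \<subseteq> S \<longrightarrow> r X \<le> r Y) \<and>
      (\<forall>X Y. X \<subseteq> S \<and> Y \<subseteq> S \<longrightarrow> r X + r Y \<ge> r (X \<union> Y) + r (X \<inter> Y)))"

definition matroid_rank :: "'a matroid \<Rightarrow> nat" where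
  "matroid_rank M = rk M (ground M)"

definition loop :: "'a matroid \<Rightarrow> 'a \<Rightarrow> bool" where
  "loop M a \<longleftrightarrow> a \<in> ground M \<and> rk M {a} = 0"

definition flat :: "'a matroid \<Rightarrow> 'a set \<Rightarrow> bool" where
  "flat M F \<longleftrightarrow> F \<subseteq> ground M \<and> (\<forall>x\<in>ground M - F. rk M (F \<union> {x}) > rk M F)"

(* By monotonicity of the rank function the subtraction on nat does not truncate. *)
definition contract :: "'a matroid \<Rightarrow> 'a \<Rightarrow> 'a matroid" where
  "contract M p =
    Matroid (ground M - {p}) (\<lambda>X\<in>Pow (ground M - {p}). rk M (X \<union> {p}) - rk M {p})"

definition modular_pair :: "'a matroid \<Rightarrow> 'a set \<Rightarrow> 'a set \<Rightarrow> bool" where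
  "modular_pair M X Y \<longleftrightarrow> rk M X + rk M Y = rk M (X \<union> Y) + rk M (X \<inter> Y)"

definition modular_ideal :: "'a matroid \<Rightarrow> 'a set set \<Rightarrow> bool" where
  "modular_ideal M \<I> \<longleftrightarrow>
    \<I> \<noteq> {} \<and>
    simplicial_complex (ground M) \<I> \<and>
    (\<forall>a\<in>ground M. \<not> loop M a \<longrightarrow> {a} \<in> \<I>) \<and>
    (\<forall>X\<in>\<I>. \<forall>Y\<in>\<I>. modular_pair M X Y \<longrightarrow> X \<union> Y \<in> \<I>)"

(* The arguments are in the order of the arrow N \<rightarrow> M. *)
definition quotient_map :: "'a matroid \<Rightarrow> 'a matroid \<Rightarrow> bool" where
  "quotient_map N M \<longleftrightarrow>
    is_matroid M \<and> is_matroid N \<and> ground N = ground M \<and> (\<forall>F. flat M F \<longrightarrow> flat N F)"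

definition elementary_quotient_map :: "'a matroid \<Rightarrow> 'a matroid \<Rightarrow> bool" where
  "elementary_quotient_map N M \<longleftrightarrow>
    quotient_map N M \<and> int (matroid_rank N) - int (matroid_rank M) \<in> {0, 1}"

definition elementary_preimage :: "'a matroid \<Rightarrow> 'a matroid \<Rightarrow> bool" where
  "elementary_preimage M N \<longleftrightarrow>
    is_matroid N \<and> ground N = ground M \<and> elementary_quotient_map N M"

definition single_element_coextension :: "'a matroid \<Rightarrow> 'a \<Rightarrow> 'a matroid \<Rightarrow> bool" where
  "single_element_coextension M p N \<longleftrightarrow>
    p \<notin> ground M \<and> is_matroid N \<and> ground N = ground M \<union> {p} \<and> M = contract N p"

definition rank_increasing_coextension :: "'a matroid \<Rightarrow> 'a \<Rightarrow> 'a matroid \<Rightarrow> bool" where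
  "rank_increasing_coextension M p N \<longleftrightarrow>
    single_element_coextension M p N \<and> matroid_rank N > matroid_rank M"

definition pointed_matroid :: "'a matroid \<times> 'a \<Rightarrow> bool" where
  "pointed_matroid P \<longleftrightarrow> is_matroid (fst P) \<and> snd P \<in> ground (fst P)"

definition Semimat :: "'a set \<Rightarrow> 'a semimatroid set" where
  "Semimat S = {D. is_semimatroid D \<and> sm_ground D = S}"

definition MatId :: "'a set \<Rightarrow> ('a matroid \<times> 'a set set) set" where
  "MatId S = {(M, \<I>). is_matroid M \<and> ground M = S \<and> modular_ideal M \<I>}"

definition MatPreim :: "'a set \<Rightarrow> ('a matroid \<times> 'a matroid) set" where
  "MatPreim S = {(M, N). is_matroid M \<and> ground M = S \<and> elementary_preimage M N}"

definition MatCoext :: "'a set \<Rightarrow> 'a \<Rightarrow> ('a matroid \<times> 'a matroid) set" where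
  "MatCoext S p = {(M, N). is_matroid M \<and> ground M = S \<and> rank_increasing_coextension M p N}"

definition Pointedmat :: "'a set \<Rightarrow> 'a \<Rightarrow> ('a matroid \<times> 'a) set" where
  "Pointedmat S p =
    {(M, q). pointed_matroid (M, q) \<and> ground M = S \<union> {p} \<and> q = p \<and> \<not> loop M p}"

end

theory Submission
  imports Defs
begin

text \<open>
  A semimatroid is recovered from its complex together with the matroid \<open>M\<close> whose rank of \<open>X\<close> is
  the largest rank of a member of the complex contained in \<open>X\<close>; conversely a modular ideal contains
  every independent set, so restricting \<open>r\<^sub>M\<close> to it loses nothing. An elementary
  preimage \<open>N\<close> of \<open>M\<close> is encoded by the difference \<open>r\<^sub>N - r\<^sub>M\<close>, which is monotone with values
  in \<open>{0, 1}\<close>: the modular ideal is its zero set. Finally \<open>N\<close> and \<open>M\<close> are the deletion and the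
  contraction of the non-loop \<open>p\<close> in the coextension.
\<close>

section \<open>Matroids\<close>

text \<open>\<open>restrict\<close> supplies the extensionality that \<open>is_matroid\<close>
  demands, so a matroid given by a formula needs only a finite ground set and the three rank
  inequalities on its subsets.\<close>

lemma is_matroidI:
  assumes "finite S"
    and "\<And>X. X \<subseteq> S \<Longrightarrow> r X \<le> card X"
    and "\<And>X Y. X \<subseteq> Y \<Longrightarrow> Y \<subseteq> S \<Longrightarrow> r X \<le> r Y"
    and "\<And>X Y. X \<subseteq> S \<Longrightarrow> Y \<subseteq> S \<Longrightarrow> r (X \<union> Y) + r (X \<inter> Y) \<le> r X + r Y"
  shows "is_matroid (Matroid S (restrict r (Pow S)))"
proof -
  have "restrict r (Pow S) X \<le> restrict r (Pow S) Y" if "X \<subseteq> Y" "Y \<subseteq> S" for X Y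
    using that assms(3)[OF that] by (auto simp: restrict_def)
  moreover have "restrict r (Pow S) (X \<union> Y) + restrict r (Pow S) (X \<inter> Y)
      \<le> restrict r (Pow S) X + restrict r (Pow S) Y" if "X \<subseteq> S" "Y \<subseteq> S" for X Y
    using that assms(4)[OF that] by (auto simp: restrict_def)
  ultimately show ?thesis
    using assms(1,2) by (simp add: is_matroid_def Let_def)
qed

lemma matroid_eqI:
  assumes "is_matroid M" "is_matroid N" "ground M = ground N"
    and "\<And>X. X \<subseteq> ground M \<Longrightarrow> rk M X = rk N X"
  shows "M = N"
proof -
  have "rk M \<in> Pow (ground M) \<rightarrow>\<^sub>E UNIV" "rk N \<in> Pow (ground M) \<rightarrow>\<^sub>E UNIV"
    using assms(1-3) by (auto simp: is_matroid_def Let_def)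
  then have "rk M = rk N"
    by (rule PiE_ext) (use assms(4) in auto)
  then show ?thesis
    using assms(3) by (simp add: matroid.expand)
qed

lemma finite_ground: "is_matroid M \<Longrightarrow> finite (ground M)"
  by (simp add: is_matroid_def Let_def)

lemma rk_le_card: "is_matroid M \<Longrightarrow> X \<subseteq> ground M \<Longrightarrow> rk M X \<le> card X"
  by (simp add: is_matroid_def Let_def)

lemma rk_mono: "is_matroid M \<Longrightarrow> X \<subseteq> Y \<Longrightarrow> Y \<subseteq> ground M \<Longrightarrow> rk M X \<le> rk M Y"
  by (simp add: is_matroid_def Let_def)

lemma rk_submodular:
  "is_matroid M \<Longrightarrow> X \<subseteq> ground M \<Longrightarrow> Y \<subseteq> ground M \<Longrightarrow>
    rk M (X \<union> Y) + rk M (X \<inter> Y) \<le> rk M X + rk M Y"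
  by (simp add: is_matroid_def Let_def)

lemma rk_empty: "is_matroid M \<Longrightarrow> rk M {} = 0"
  using rk_le_card[of M "{}"] by simp

lemma rk_insert_le:
  assumes "is_matroid M" "X \<subseteq> ground M" "a \<in> ground M"
  shows "rk M (insert a X) \<le> Suc (rk M X)"
proof -
  have "rk M (X \<union> {a}) + rk M (X \<inter> {a}) \<le> rk M X + rk M {a}"
    using assms by (intro rk_submodular) auto
  moreover have "rk M {a} \<le> 1"
    using rk_le_card[OF assms(1), of "{a}"] assms(3) by simp
  ultimately show ?thesis by simp
qed

text \<open>Diminishing increments, from submodularity of the pair \<open>insert a X\<close>,
  \<open>Y\<close>: its union is \<open>insert a Y\<close> and, since \<open>a \<notin> Y\<close>,
  its intersection is \<open>X\<close>.\<close>

lemma rk_insert_antimono: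
  assumes M: "is_matroid M" and "X \<subseteq> Y" "Y \<subseteq> ground M" "a \<in> ground M"
    and "rk M Y < rk M (insert a Y)"
  shows "rk M X < rk M (insert a X)"
proof -
  have "a \<notin> Y" using assms(5) by (auto simp: insert_absorb)
  then have "insert a X \<union> Y = insert a Y" "insert a X \<inter> Y = X"
    using assms(2) by auto
  then have "rk M (insert a Y) + rk M X \<le> rk M (insert a X) + rk M Y"
    using rk_submodular[OF M, of "insert a X" Y] assms(2-4) by auto
  then show ?thesis using assms(5) by simp
qed

text \<open>Induction on the finite set \<open>Y\<close>: by diminishing increments, an element that
  does not raise the rank of \<open>X\<close> cannot raise the rank of a larger set either.\<close>

lemma rk_eq_if_insert_eq:
  assumes M: "is_matroid M" and "X \<subseteq> ground M" "Y \<subseteq> ground M"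
    and "\<And>y. y \<in> Y \<Longrightarrow> rk M (insert y X) = rk M X"
  shows "rk M (X \<union> Y) = rk M X"
proof -
  have "finite Y" using assms(3) finite_ground[OF M] finite_subset by blast
  then show ?thesis using assms(3,4)
  proof (induction Y)
    case (insert y Y)
    have "\<not> rk M (X \<union> Y) < rk M (insert y (X \<union> Y))"
      using rk_insert_antimono[OF M, of X "X \<union> Y" y] insert.prems(2)[of y] insert.prems(1) assms(2)
      by auto
    moreover have "rk M (X \<union> Y) \<le> rk M (insert y (X \<union> Y))"
      using insert.prems(1) assms(2) by (intro rk_mono[OF M]) auto
    ultimately show ?case
      using insert.IH insert.prems by simp
  qed simp
qed

text \<open>\<open>F\<close> is the closure of \<open>X\<close>. Its elements leave the rank
  unchanged one by one, hence also together; an element outside \<open>F\<close> raises the rank of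
  \<open>X\<close> by definition, so with \<open>F\<close> it exceeds the common rank of
  \<open>X\<close> and \<open>F\<close>.\<close>

lemma flat_closure:
  assumes M: "is_matroid M" and X: "X \<subseteq> ground M"
  defines "F \<equiv> {y \<in> ground M. rk M (insert y X) = rk M X}"
  shows "X \<subseteq> F" and "rk M F = rk M X" and "flat M F"
proof -
  show XF: "X \<subseteq> F" using X by (auto simp: F_def insert_absorb)
  have FG: "F \<subseteq> ground M" by (auto simp: F_def)
  have "rk M (X \<union> F) = rk M X"
    using FG by (intro rk_eq_if_insert_eq[OF M X]) (auto simp: F_def)
  then show rF: "rk M F = rk M X" using XF by (simp add: Un_absorb1)
  have "rk M F < rk M (F \<union> {x})" if x: "x \<in> ground M - F" for x
  proof -
    have "rk M X < rk M (insert x X)"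
    proof (rule le_neq_implies_less)
      show "rk M X \<le> rk M (insert x X)" using x X by (intro rk_mono[OF M]) auto
      show "rk M X \<noteq> rk M (insert x X)" using x by (auto simp: F_def)
    qed
    also have "\<dots> \<le> rk M (F \<union> {x})"
      using XF FG x by (intro rk_mono[OF M]) auto
    finally show ?thesis using rF by simp
  qed
  then show "flat M F" using FG by (auto simp: flat_def)
qed

section \<open>Modular ideals\<close>

lemma modular_ideal_subset: "modular_ideal M I \<Longrightarrow> X \<in> I \<Longrightarrow> X \<subseteq> ground M"
  by (auto simp: modular_ideal_def simplicial_complex_def)

lemma modular_ideal_down: "modular_ideal M I \<Longrightarrow> X \<in> I \<Longrightarrow> Y \<subseteq> X \<Longrightarrow> Y \<in> I"
  by (auto simp: modular_ideal_def simplicial_complex_def)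

lemma modular_ideal_Un: "modular_ideal M I \<Longrightarrow> X \<in> I \<Longrightarrow> Y \<in> I \<Longrightarrow> modular_pair M X Y \<Longrightarrow> X \<union> Y \<in> I"
  by (auto simp: modular_ideal_def)

lemma modular_ideal_empty: "modular_ideal M I \<Longrightarrow> {} \<in> I"
  by (auto simp: modular_ideal_def simplicial_complex_def)

text \<open>An element that raises the rank of \<open>X\<close> is not a loop, so \<open>{a}\<close>
  lies in \<open>I\<close>. The rank grows by exactly 1, which makes \<open>X\<close> and
  \<open>{a}\<close> a modular pair, and their union stays in \<open>I\<close>.\<close>

lemma modular_ideal_insert:
  assumes M: "is_matroid M" and I: "modular_ideal M I"
    and X: "X \<in> I" "a \<in> ground M" "rk M X < rk M (insert a X)"
  shows "insert a X \<in> I"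
proof -
  have XG: "X \<subseteq> ground M" using modular_ideal_subset[OF I X(1)] .
  have aX: "a \<notin> X" using X(3) by (auto simp: insert_absorb)
  have "rk M {} < rk M {a}"
    using rk_insert_antimono[OF M, of "{}" X a] X XG by auto
  moreover have "rk M {a} \<le> 1"
    using rk_le_card[OF M, of "{a}"] X by simp
  ultimately have ra: "rk M {a} = 1" by simp
  then have aI: "{a} \<in> I" using I X(2) by (auto simp: modular_ideal_def loop_def)
  have "rk M (insert a X) = Suc (rk M X)"
    using rk_insert_le[OF M XG X(2)] X(3) by simp
  then have "modular_pair M X {a}"
    using ra aX rk_empty[OF M] by (simp add: modular_pair_def)
  then show ?thesis using modular_ideal_Un[OF I X(1) aI] by simp
qed

text \<open>If no element of \<open>Y\<close> raised the rank of \<open>X\<close>, then neither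
  would all of \<open>Y\<close>. An element that does raise it can be added without leaving the
  ideal. This is the source of the exchange axiom for the semimatroid of an ideal.\<close>

lemma modular_ideal_extend:
  assumes M: "is_matroid M" and I: "modular_ideal M I"
    and XY: "X \<in> I" "Y \<subseteq> ground M" "rk M X < rk M (X \<union> Y)"
  shows "\<exists>y\<in>Y - X. rk M X < rk M (insert y X) \<and> insert y X \<in> I"
proof -
  have XG: "X \<subseteq> ground M" using modular_ideal_subset[OF I XY(1)] .
  obtain y where y: "y \<in> Y" "rk M (insert y X) \<noteq> rk M X"
    using rk_eq_if_insert_eq[OF M XG XY(2)] XY(3) by auto
  then have lt: "rk M X < rk M (insert y X)"
    using rk_mono[OF M, of X "insert y X"] XG XY(2) by fastforce
  moreover have "y \<notin> X" using y(2) by (auto simp: insert_absorb)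
  ultimately show ?thesis
    using modular_ideal_insert[OF M I XY(1) _ lt] y XY(2) by auto
qed

text \<open>When an independent set is built one element at a time, every step raises the rank, so
  no step leaves the ideal.\<close>

lemma independent_in_modular_ideal:
  assumes M: "is_matroid M" and I: "modular_ideal M I"
    and X: "X \<subseteq> ground M" "rk M X = card X"
  shows "X \<in> I"
proof -
  have "finite X" using X(1) finite_ground[OF M] finite_subset by blast
  then show ?thesis using X
  proof (induction X)
    case empty
    show ?case using modular_ideal_empty[OF I] .
  next
    case (insert a X)
    have "rk M X \<le> card X" "rk M (insert a X) \<le> Suc (rk M X)"
      using insert.prems(1) by (simp_all add: rk_le_card[OF M] rk_insert_le[OF M])
    then have "rk M X = card X" "rk M X < rk M (insert a X)"
      using insert.prems insert.hyps by auto
    then show ?case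
      using insert by (intro modular_ideal_insert[OF M I]) auto
  qed
qed

text \<open>A maximal member of \<open>I\<close> inside \<open>X\<close> must have full rank, since
  otherwise it could be extended by an element of \<open>X\<close>. Hence \<open>rk M\<close> is
  determined by its values on \<open>I\<close>.\<close>

lemma modular_ideal_spanning_subset:
  assumes M: "is_matroid M" and I: "modular_ideal M I" and X: "X \<subseteq> ground M"
  shows "\<exists>Y\<in>I. Y \<subseteq> X \<and> rk M Y = rk M X"
proof -
  define A where "A = {Y \<in> I. Y \<subseteq> X}"
  have "finite A"
    using X finite_ground[OF M] finite_subset[of A "Pow X"] finite_subset[of X] by (auto simp: A_def)
  moreover have "{} \<in> A" using modular_ideal_empty[OF I] by (simp add: A_def)
  ultimately obtain Y where Y: "Y \<in> A" "\<And>Z. Z \<in> A \<Longrightarrow> Y \<subseteq> Z \<Longrightarrow> Y = Z"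
    using finite_has_maximal[of A] by blast
  have "\<not> rk M Y < rk M X"
  proof
    assume "rk M Y < rk M X"
    moreover have "Y \<union> X = X" using Y(1) by (auto simp: A_def)
    ultimately obtain y where "y \<in> X - Y" "insert y Y \<in> I"
      using modular_ideal_extend[OF M I, of Y X] Y(1) X by (auto simp: A_def)
    then show False using Y(1) Y(2)[of "insert y Y"] by (auto simp: A_def)
  qed
  then have "rk M Y = rk M X"
    using rk_mono[OF M, of Y X] Y(1) X by (auto simp: A_def)
  then show ?thesis using Y(1) by (auto simp: A_def)
qed

section \<open>Semimatroids and modular ideals\<close>

text \<open>For a semimatroid \<open>D\<close> the argument of \<open>Max\<close> is finite and
  contains the rank of \<open>{}\<close>, so the maximum is meaningful for every
  \<open>X\<close>.\<close>

definition semimatroid_matroid :: "'a semimatroid \<Rightarrow> 'a matroid" where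
  "semimatroid_matroid D = Matroid (sm_ground D)
    (\<lambda>X\<in>Pow (sm_ground D). Max (sm_rank D ` {Y \<in> sm_complex D. Y \<subseteq> X}))"

definition ideal_semimatroid :: "'a matroid \<times> 'a set set \<Rightarrow> 'a semimatroid" where
  "ideal_semimatroid = (\<lambda>(M, I). Semimatroid (ground M) I (restrict (rk M) I))"

section \<open>The matroid and the modular ideal of a semimatroid\<close>

context
  fixes D :: "'a semimatroid"
  assumes D: "is_semimatroid D"
begin

text \<open>Cited by position below: item 8 is submodularity within the complex, item 9 the axiom
  that yields unions, item 10 the exchange axiom.\<close>

lemma semimatroid_axioms:
  shows "finite (sm_ground D)"
    and "X \<in> sm_complex D \<Longrightarrow> X \<subseteq> sm_ground D"
    and "X \<in> sm_complex D \<Longrightarrow> Y \<subseteq> X \<Longrightarrow> Y \<in> sm_complex D"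
    and "{} \<in> sm_complex D"
    and "sm_rank D \<in> sm_complex D \<rightarrow>\<^sub>E UNIV"
    and "X \<in> sm_complex D \<Longrightarrow> sm_rank D X \<le> card X"
    and "Y \<in> sm_complex D \<Longrightarrow> X \<subseteq> Y \<Longrightarrow> sm_rank D X \<le> sm_rank D Y"
    and "X \<in> sm_complex D \<Longrightarrow> Y \<in> sm_complex D \<Longrightarrow> X \<union> Y \<in> sm_complex D \<Longrightarrow>
      sm_rank D (X \<union> Y) + sm_rank D (X \<inter> Y) \<le> sm_rank D X + sm_rank D Y"
    and "X \<in> sm_complex D \<Longrightarrow> Y \<in> sm_complex D \<Longrightarrow> sm_rank D X = sm_rank D (X \<inter> Y) \<Longrightarrow>
      X \<union> Y \<in> sm_complex D"
    and "X \<in> sm_complex D \<Longrightarrow> Y \<in> sm_complex D \<Longrightarrow> sm_rank D X < sm_rank D Y \<Longrightarrow>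
      \<exists>y\<in>Y - X. X \<union> {y} \<in> sm_complex D"
proof -
  note D' = D[unfolded is_semimatroid_def simplicial_complex_def Let_def]
  show "X \<in> sm_complex D \<Longrightarrow> X \<subseteq> sm_ground D" using D' by (meson PowD in_mono)
  have "\<exists>X. X \<in> sm_complex D" using D' by (meson ex_in_conv)
  then show "{} \<in> sm_complex D" using D' by (meson empty_subsetI)
qed (use D in \<open>simp_all add: is_semimatroid_def simplicial_complex_def Let_def\<close>)

text \<open>The complex is finite. Its maximal members inside \<open>X\<close> play the role of
  bases of \<open>X\<close>, and prescribing a lower bound \<open>A\<close> permits nested choices
  of them.\<close>

lemma maximal_in_complex:
  assumes "A \<in> sm_complex D" "A \<subseteq> X"
  obtains B where "B \<in> sm_complex D" "A \<subseteq> B" "B \<subseteq> X"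
    and "\<And>Z. Z \<in> sm_complex D \<Longrightarrow> B \<subseteq> Z \<Longrightarrow> Z \<subseteq> X \<Longrightarrow> Z = B"
proof -
  define K where "K = {Y \<in> sm_complex D. A \<subseteq> Y \<and> Y \<subseteq> X}"
  have "finite K"
    using semimatroid_axioms(1,2) finite_subset[of K "Pow (sm_ground D)"] by (auto simp: K_def)
  moreover have "A \<in> K" using assms by (simp add: K_def)
  ultimately obtain B where B: "B \<in> K" "\<And>Z. Z \<in> K \<Longrightarrow> B \<subseteq> Z \<Longrightarrow> B = Z"
    using finite_has_maximal[of K] by blast
  then have "Z = B" if "Z \<in> sm_complex D" "B \<subseteq> Z" "Z \<subseteq> X" for Z
    using that B(2)[of Z] by (auto simp: K_def)
  then show thesis using that[of B] B(1) by (auto simp: K_def)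
qed

text \<open>Every maximal member attains the maximum: if some member inside \<open>X\<close> had
  larger rank than \<open>B\<close>, the exchange axiom would enlarge \<open>B\<close> by one of its
  elements, still inside \<open>X\<close>.\<close>

lemma rk_semimatroid_matroid:
  assumes X: "X \<subseteq> sm_ground D" and B: "B \<in> sm_complex D" "B \<subseteq> X"
    and max: "\<And>Z. Z \<in> sm_complex D \<Longrightarrow> B \<subseteq> Z \<Longrightarrow> Z \<subseteq> X \<Longrightarrow> Z = B"
  shows "rk (semimatroid_matroid D) X = sm_rank D B"
proof -
  have "Max (sm_rank D ` {Y \<in> sm_complex D. Y \<subseteq> X}) = sm_rank D B"
  proof (rule Max_eqI)
    show "finite (sm_rank D ` {Y \<in> sm_complex D. Y \<subseteq> X})"
      using semimatroid_axioms(1) X finite_subset[of _ "Pow X"] finite_subset[of X]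
      by (intro finite_imageI) auto
    show "sm_rank D B \<in> sm_rank D ` {Y \<in> sm_complex D. Y \<subseteq> X}"
      using B by blast
  next
    fix n assume "n \<in> sm_rank D ` {Y \<in> sm_complex D. Y \<subseteq> X}"
    then obtain Y where Y: "Y \<in> sm_complex D" "Y \<subseteq> X" "n = sm_rank D Y" by blast
    show "n \<le> sm_rank D B"
    proof (rule ccontr)
      assume "\<not> n \<le> sm_rank D B"
      then obtain y where "y \<in> Y - B" "B \<union> {y} \<in> sm_complex D"
        using semimatroid_axioms(10)[OF B(1) Y(1)] Y(3) by auto
      then show False using max[of "B \<union> {y}"] B(2) Y(2) by auto
    qed
  qed
  then show ?thesis using X by (simp add: semimatroid_matroid_def)
qed

text \<open>A member of the complex is the only maximal member inside itself.\<close>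

lemma rk_semimatroid_matroid_complex:
  assumes "X \<in> sm_complex D"
  shows "rk (semimatroid_matroid D) X = sm_rank D X"
  using assms semimatroid_axioms(2) by (intro rk_semimatroid_matroid) auto

lemma rk_semimatroid_matroid_ge:
  assumes "X \<subseteq> sm_ground D" "Y \<in> sm_complex D" "Y \<subseteq> X"
  shows "sm_rank D Y \<le> rk (semimatroid_matroid D) X"
proof -
  obtain B where B: "B \<in> sm_complex D" "Y \<subseteq> B" "B \<subseteq> X"
    "\<And>Z. Z \<in> sm_complex D \<Longrightarrow> B \<subseteq> Z \<Longrightarrow> Z \<subseteq> X \<Longrightarrow> Z = B"
    using maximal_in_complex[OF assms(2,3)] by metis
  then have "rk (semimatroid_matroid D) X = sm_rank D B"
    using rk_semimatroid_matroid[OF assms(1)] by blast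
  then show ?thesis using semimatroid_axioms(7)[OF B(1,2)] by simp
qed

lemma rk_semimatroid_matroid_attained:
  assumes "X \<subseteq> sm_ground D"
  obtains B where "B \<in> sm_complex D" "B \<subseteq> X" "rk (semimatroid_matroid D) X = sm_rank D B"
proof -
  obtain B where "B \<in> sm_complex D" "B \<subseteq> X"
    "\<And>Z. Z \<in> sm_complex D \<Longrightarrow> B \<subseteq> Z \<Longrightarrow> Z \<subseteq> X \<Longrightarrow> Z = B"
    using maximal_in_complex[OF semimatroid_axioms(4), of X] by auto
  then show thesis using that rk_semimatroid_matroid[OF assms] by blast
qed

text \<open>A maximal member \<open>A\<close> of the complex inside \<open>X \<inter> Y\<close>, extended to \<open>B\<close> inside \<open>X\<close> and then
  to \<open>E\<close> inside \<open>X \<union> Y\<close>, satisfies \<open>E \<inter> X = B\<close> and \<open>E \<inter> X \<inter> Y = A\<close>, which reduces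
  submodularity to that of the pair \<open>E \<inter> X\<close>, \<open>E \<inter> Y\<close> inside the complex.\<close>
lemma rk_semimatroid_matroid_submodular:
  assumes X: "X \<subseteq> sm_ground D" and Y: "Y \<subseteq> sm_ground D"
  shows "rk (semimatroid_matroid D) (X \<union> Y) + rk (semimatroid_matroid D) (X \<inter> Y)
    \<le> rk (semimatroid_matroid D) X + rk (semimatroid_matroid D) Y"
proof -
  obtain A where A: "A \<in> sm_complex D" "A \<subseteq> X \<inter> Y"
    "\<And>Z. Z \<in> sm_complex D \<Longrightarrow> A \<subseteq> Z \<Longrightarrow> Z \<subseteq> X \<inter> Y \<Longrightarrow> Z = A"
    using maximal_in_complex[OF semimatroid_axioms(4), of "X \<inter> Y"] by auto
  obtain B where B: "B \<in> sm_complex D" "A \<subseteq> B" "B \<subseteq> X"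
    "\<And>Z. Z \<in> sm_complex D \<Longrightarrow> B \<subseteq> Z \<Longrightarrow> Z \<subseteq> X \<Longrightarrow> Z = B"
    using maximal_in_complex[OF A(1), of X] A(2) by auto
  obtain E where E: "E \<in> sm_complex D" "B \<subseteq> E" "E \<subseteq> X \<union> Y"
    "\<And>Z. Z \<in> sm_complex D \<Longrightarrow> E \<subseteq> Z \<Longrightarrow> Z \<subseteq> X \<union> Y \<Longrightarrow> Z = E"
    using maximal_in_complex[OF B(1), of "X \<union> Y"] B(3) by auto
  have EX: "E \<inter> X \<in> sm_complex D" and EY: "E \<inter> Y \<in> sm_complex D"
    and EXY: "E \<inter> X \<inter> Y \<in> sm_complex D"
    by (rule semimatroid_axioms(3)[OF E(1)], blast)+
  have "E \<inter> X = B" using B(4)[OF EX] E(2) B(3) by auto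
  moreover have "(E \<inter> X) \<inter> (E \<inter> Y) = A" using A(3)[OF EXY] E(2) B(2) A(2) by auto
  moreover have un: "(E \<inter> X) \<union> (E \<inter> Y) = E" using E(3) by auto
  ultimately have "sm_rank D E + sm_rank D A \<le> sm_rank D B + sm_rank D (E \<inter> Y)"
    using semimatroid_axioms(8)[OF EX EY] E(1) by simp
  moreover have "rk (semimatroid_matroid D) (X \<inter> Y) = sm_rank D A"
    using X A by (intro rk_semimatroid_matroid) auto
  moreover have "rk (semimatroid_matroid D) X = sm_rank D B"
    by (rule rk_semimatroid_matroid[OF X B(1,3,4)])
  moreover have "rk (semimatroid_matroid D) (X \<union> Y) = sm_rank D E"
    using X Y by (intro rk_semimatroid_matroid E) auto
  \<comment> \<open>\<open>E \<inter> Y\<close> need not be maximal inside \<open>Y\<close>, but an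
    upper bound on its rank is enough.\<close>
  moreover have "sm_rank D (E \<inter> Y) \<le> rk (semimatroid_matroid D) Y"
    by (rule rk_semimatroid_matroid_ge[OF Y EY]) simp
  ultimately show ?thesis by linarith
qed

lemma ground_semimatroid_matroid: "ground (semimatroid_matroid D) = sm_ground D"
  by (simp add: semimatroid_matroid_def)

lemma is_matroid_semimatroid_matroid: "is_matroid (semimatroid_matroid D)"
proof -
  let ?r = "rk (semimatroid_matroid D)"
  have "is_matroid (Matroid (sm_ground D) (restrict ?r (Pow (sm_ground D))))"
  proof (rule is_matroidI)
    show "finite (sm_ground D)" by (rule semimatroid_axioms(1))
  next
    fix X assume X: "X \<subseteq> sm_ground D"
    then obtain B where B: "B \<in> sm_complex D" "B \<subseteq> X" "?r X = sm_rank D B"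
      by (rule rk_semimatroid_matroid_attained)
    have "finite X" using X semimatroid_axioms(1) finite_subset by blast
    then show "?r X \<le> card X"
      using B semimatroid_axioms(6)[OF B(1)] card_mono[of X B] by linarith
  next
    fix X Y assume XY: "X \<subseteq> Y" "Y \<subseteq> sm_ground D"
    then obtain B where B: "B \<in> sm_complex D" "B \<subseteq> X" "?r X = sm_rank D B"
      using rk_semimatroid_matroid_attained[of X] by blast
    then show "?r X \<le> ?r Y"
      using rk_semimatroid_matroid_ge[OF XY(2) B(1)] XY(1) by auto
  qed (rule rk_semimatroid_matroid_submodular)
  moreover have "Matroid (sm_ground D) (restrict ?r (Pow (sm_ground D))) = semimatroid_matroid D"
    by (simp add: semimatroid_matroid_def)
  ultimately show ?thesis by simp
qed

text \<open>If \<open>a\<close> is not a loop, some member inside \<open>{a}\<close> has positive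
  rank and can only be \<open>{a}\<close>. For a modular pair, take a maximal member
  \<open>E\<close> between \<open>X\<close> and \<open>X \<union> Y\<close>. Modularity forces
  \<open>E \<inter> Y\<close> to have the rank of \<open>Y\<close>, and then the union axiom for
  \<open>Y\<close> and \<open>E\<close> yields \<open>X \<union> Y\<close>.\<close>

lemma modular_ideal_complex: "modular_ideal (semimatroid_matroid D) (sm_complex D)"
  unfolding modular_ideal_def ground_semimatroid_matroid
proof (intro conjI ballI impI)
  show "sm_complex D \<noteq> {}" using semimatroid_axioms(4) by blast
  show "simplicial_complex (sm_ground D) (sm_complex D)"
    using D by (simp add: is_semimatroid_def Let_def)
next
  fix a assume a: "a \<in> sm_ground D" "\<not> loop (semimatroid_matroid D) a"
  obtain B where B: "B \<in> sm_complex D" "B \<subseteq> {a}" "rk (semimatroid_matroid D) {a} = sm_rank D B"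
    using rk_semimatroid_matroid_attained[of "{a}"] a(1) by auto
  have "sm_rank D B \<noteq> 0"
    using a B(3) by (simp add: loop_def ground_semimatroid_matroid)
  then have "B \<noteq> {}" using semimatroid_axioms(6)[OF B(1)] by auto
  then show "{a} \<in> sm_complex D" using B(1,2) by (metis subset_singletonD)
next
  fix X Y assume XY: "X \<in> sm_complex D" "Y \<in> sm_complex D"
    and mod: "modular_pair (semimatroid_matroid D) X Y"
  have sub: "X \<subseteq> sm_ground D" "Y \<subseteq> sm_ground D" using XY semimatroid_axioms(2) by auto
  obtain E where E: "E \<in> sm_complex D" "X \<subseteq> E" "E \<subseteq> X \<union> Y"
    "\<And>Z. Z \<in> sm_complex D \<Longrightarrow> E \<subseteq> Z \<Longrightarrow> Z \<subseteq> X \<union> Y \<Longrightarrow> Z = E"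
    using maximal_in_complex[OF XY(1), of "X \<union> Y"] by auto
  have rE: "rk (semimatroid_matroid D) (X \<union> Y) = sm_rank D E"
    using sub by (intro rk_semimatroid_matroid E) auto
  have int: "X \<inter> Y \<in> sm_complex D" using semimatroid_axioms(3)[OF XY(1)] by auto
  have EY: "E \<inter> Y \<in> sm_complex D" using semimatroid_axioms(3)[OF E(1)] by auto
  have "X \<union> (E \<inter> Y) = E" "X \<inter> (E \<inter> Y) = X \<inter> Y" using E(2,3) by auto
  then have "sm_rank D E + sm_rank D (X \<inter> Y) \<le> sm_rank D X + sm_rank D (E \<inter> Y)"
    using semimatroid_axioms(8)[OF XY(1) EY] E(1) by simp
  moreover have "sm_rank D X + sm_rank D Y = sm_rank D E + sm_rank D (X \<inter> Y)"
    using mod rE XY int by (simp add: modular_pair_def rk_semimatroid_matroid_complex)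
  moreover have "sm_rank D (E \<inter> Y) \<le> sm_rank D Y"
    using semimatroid_axioms(7)[OF XY(2)] by simp
  \<comment> \<open>The submodular inequality and the modular identity bound the rank of
    \<open>Y\<close> by that of \<open>E \<inter> Y\<close>; monotonicity gives the reverse.\<close>
  ultimately have "sm_rank D Y = sm_rank D (Y \<inter> E)" by (simp add: Int_commute)
  then have "Y \<union> E \<in> sm_complex D" using semimatroid_axioms(9)[OF XY(2) E(1)] by simp
  moreover have "Y \<union> E = X \<union> Y" using E(2,3) by auto
  ultimately show "X \<union> Y \<in> sm_complex D" by simp
qed

lemma ideal_semimatroid_inverse: "ideal_semimatroid (semimatroid_matroid D, sm_complex D) = D"
proof -
  have "restrict (rk (semimatroid_matroid D)) (sm_complex D) = sm_rank D"
    by (rule PiE_ext[OF _ semimatroid_axioms(5)]) (auto simp: rk_semimatroid_matroid_complex)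
  then show ?thesis
    by (simp add: ideal_semimatroid_def ground_semimatroid_matroid)
qed

end

section \<open>The semimatroid of a modular ideal\<close>

lemma sm_ground_ideal_semimatroid: "sm_ground (ideal_semimatroid (M, I)) = ground M"
  and sm_complex_ideal_semimatroid: "sm_complex (ideal_semimatroid (M, I)) = I"
  and sm_rank_ideal_semimatroid: "sm_rank (ideal_semimatroid (M, I)) = restrict (rk M) I"
  by (simp_all add: ideal_semimatroid_def)

text \<open>The first three rank axioms are inherited from \<open>M\<close>. If \<open>X\<close> has
  the rank of \<open>X \<inter> Y\<close>, submodularity and monotonicity give \<open>Y\<close> the
  rank of \<open>X \<union> Y\<close>, so the pair is modular. For exchange,
  \<open>X \<union> Y\<close> has rank at least that of \<open>Y\<close>, so \<open>X\<close> can be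
  extended by an element of \<open>Y\<close>.\<close>

lemma is_semimatroid_ideal_semimatroid:
  assumes M: "is_matroid M" and I: "modular_ideal M I"
  shows "is_semimatroid (ideal_semimatroid (M, I))"
proof -
  have "X \<union> Y \<in> I" if "X \<in> I" "Y \<in> I" "rk M X = rk M (X \<inter> Y)" for X Y
  proof -
    have "X \<subseteq> ground M" "Y \<subseteq> ground M" using that modular_ideal_subset[OF I] by auto
    then have "rk M (X \<union> Y) + rk M (X \<inter> Y) \<le> rk M X + rk M Y" "rk M Y \<le> rk M (X \<union> Y)"
      by (auto intro: rk_submodular[OF M] rk_mono[OF M])
    then have "modular_pair M X Y" using that(3) by (simp add: modular_pair_def)
    then show ?thesis using modular_ideal_Un[OF I that(1,2)] by simp
  qed
  moreover have "\<exists>y\<in>Y - X. insert y X \<in> I" if "X \<in> I" "Y \<in> I" "rk M X < rk M Y" for X Y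
  proof -
    have "X \<subseteq> ground M" "Y \<subseteq> ground M" using that modular_ideal_subset[OF I] by auto
    then have "rk M X < rk M (X \<union> Y)"
      using that(3) rk_mono[OF M, of Y "X \<union> Y"] by auto
    then show ?thesis using modular_ideal_extend[OF M I that(1) \<open>Y \<subseteq> ground M\<close>] by auto
  qed
  moreover have "X \<inter> Y \<in> I" if "X \<in> I" for X Y
    using modular_ideal_down[OF I that] by auto
  ultimately show ?thesis
    using finite_ground[OF M] I modular_ideal_subset[OF I] rk_le_card[OF M] rk_mono[OF M]
      rk_submodular[OF M]
    by (simp add: is_semimatroid_def ideal_semimatroid_def Let_def modular_ideal_def)
qed

text \<open>A member of \<open>I\<close> spanning \<open>X\<close> shows that the maximum reaches
  \<open>rk M X\<close>, and monotonicity of \<open>rk M\<close> shows that it goes no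
  further.\<close>

lemma semimatroid_matroid_inverse:
  assumes M: "is_matroid M" and I: "modular_ideal M I"
  shows "semimatroid_matroid (ideal_semimatroid (M, I)) = M"
proof (rule matroid_eqI)
  let ?D = "ideal_semimatroid (M, I)"
  have D: "is_semimatroid ?D" by (rule is_semimatroid_ideal_semimatroid[OF M I])
  note sel = sm_ground_ideal_semimatroid sm_complex_ideal_semimatroid sm_rank_ideal_semimatroid
  show "is_matroid (semimatroid_matroid ?D)" by (rule is_matroid_semimatroid_matroid[OF D])
  show "ground (semimatroid_matroid ?D) = ground M"
    by (simp add: semimatroid_matroid_def sel)
  fix X assume "X \<subseteq> ground (semimatroid_matroid ?D)"
  then have X: "X \<subseteq> ground M" by (simp add: semimatroid_matroid_def sel)
  obtain B where B: "B \<in> I" "B \<subseteq> X" "rk (semimatroid_matroid ?D) X = rk M B"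
    using rk_semimatroid_matroid_attained[OF D, of X] X by (auto simp: sel)
  obtain Y where Y: "Y \<in> I" "Y \<subseteq> X" "rk M Y = rk M X"
    using modular_ideal_spanning_subset[OF M I X] by auto
  have "rk M X \<le> rk (semimatroid_matroid ?D) X"
    using rk_semimatroid_matroid_ge[OF D, of X Y] X Y by (simp add: sel)
  then show "rk (semimatroid_matroid ?D) X = rk M X"
    using B rk_mono[OF M B(2) X] by simp
qed (rule M)

lemma bij_betw_Semimat_MatId:
  "bij_betw (\<lambda>D. (semimatroid_matroid D, sm_complex D)) (Semimat S) (MatId S)"
proof (rule bij_betw_byWitness[where f' = ideal_semimatroid])
  show "\<forall>D\<in>Semimat S. ideal_semimatroid (semimatroid_matroid D, sm_complex D) = D"
    by (auto simp: Semimat_def ideal_semimatroid_inverse)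
  show "\<forall>P\<in>MatId S. (semimatroid_matroid (ideal_semimatroid P),
      sm_complex (ideal_semimatroid P)) = P"
    by (auto simp: MatId_def semimatroid_matroid_inverse sm_complex_ideal_semimatroid)
  show "(\<lambda>D. (semimatroid_matroid D, sm_complex D)) ` Semimat S \<subseteq> MatId S"
    by (auto simp: Semimat_def MatId_def is_matroid_semimatroid_matroid
        ground_semimatroid_matroid modular_ideal_complex)
  show "ideal_semimatroid ` MatId S \<subseteq> Semimat S"
    by (auto simp: Semimat_def MatId_def is_semimatroid_ideal_semimatroid
        sm_ground_ideal_semimatroid)
qed

section \<open>Modular ideals and elementary preimages\<close>

definition ideal_preimage :: "'a matroid \<Rightarrow> 'a set set \<Rightarrow> 'a matroid" where
  "ideal_preimage M I = Matroid (ground M)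
    (\<lambda>X\<in>Pow (ground M). rk M X + (if X \<in> I then 0 else 1))"

definition preimage_ideal :: "'a matroid \<Rightarrow> 'a matroid \<Rightarrow> 'a set set" where
  "preimage_ideal M N = {X \<in> Pow (ground M). rk N X = rk M X}"

text \<open>Each rank axiom rests on one property of \<open>I\<close>. The bound by cardinality
  holds because sets outside \<open>I\<close> are dependent, monotonicity because \<open>I\<close>
  is closed under subsets, and submodularity because of closure under unions of modular
  pairs.\<close>

lemma is_matroid_ideal_preimage:
  assumes M: "is_matroid M" and I: "modular_ideal M I"
  shows "is_matroid (ideal_preimage M I)"
  unfolding ideal_preimage_def
proof (rule is_matroidI)
  show "finite (ground M)" by (rule finite_ground[OF M])
next
  fix X assume X: "X \<subseteq> ground M"
  then show "rk M X + (if X \<in> I then 0 else 1) \<le> card X"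
    using rk_le_card[OF M X] independent_in_modular_ideal[OF M I X] by fastforce
next
  fix X Y assume "X \<subseteq> Y" "Y \<subseteq> ground M"
  then show "rk M X + (if X \<in> I then 0 else 1) \<le> rk M Y + (if Y \<in> I then 0 else 1)"
    using rk_mono[OF M, of X Y] modular_ideal_down[OF I, of Y X] by auto
next
  fix X Y assume XY: "X \<subseteq> ground M" "Y \<subseteq> ground M"
  note sub = rk_submodular[OF M XY]
  \<comment> \<open>The critical case: the indicator adds 1 on the left and nothing on the right,
    and the failure of modularity supplies the missing unit.\<close>
  have "rk M (X \<union> Y) + rk M (X \<inter> Y) < rk M X + rk M Y" if "X \<in> I" "Y \<in> I" "X \<union> Y \<notin> I"
    using sub that modular_ideal_Un[OF I that(1,2)] by (fastforce simp: modular_pair_def le_less)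
  moreover have "X \<inter> Y \<in> I" if "X \<in> I \<or> Y \<in> I"
    using that modular_ideal_down[OF I] by (meson Int_lower1 Int_lower2)
  moreover have "X \<in> I \<and> Y \<in> I" if "X \<union> Y \<in> I"
    using that modular_ideal_down[OF I] by (meson Un_upper1 Un_upper2)
  ultimately show "rk M (X \<union> Y) + (if X \<union> Y \<in> I then 0 else 1)
      + (rk M (X \<inter> Y) + (if X \<inter> Y \<in> I then 0 else 1))
    \<le> rk M X + (if X \<in> I then 0 else 1) + (rk M Y + (if Y \<in> I then 0 else 1))"
    using sub by (auto split: if_splits)
qed

text \<open>Flats stay flats because the added term cannot drop from \<open>F\<close> to
  \<open>F \<union> {x}\<close>: if the larger set lies in \<open>I\<close>, so does the smaller. On
  the ground set the added term is 0 or 1.\<close>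

lemma elementary_preimage_ideal_preimage:
  assumes M: "is_matroid M" and I: "modular_ideal M I"
  shows "elementary_preimage M (ideal_preimage M I)"
proof -
  let ?N = "ideal_preimage M I"
  have N: "is_matroid ?N" by (rule is_matroid_ideal_preimage[OF M I])
  have g: "ground ?N = ground M" by (simp add: ideal_preimage_def)
  have "flat ?N F" if F: "flat M F" for F
    unfolding flat_def g
  proof (intro conjI ballI)
    show FG: "F \<subseteq> ground M" using F by (simp add: flat_def)
    fix x assume x: "x \<in> ground M - F"
    then have "rk M F < rk M (F \<union> {x})" using F by (simp add: flat_def)
    moreover have "F \<in> I" if "F \<union> {x} \<in> I"
      using modular_ideal_down[OF I that] by auto
    ultimately show "rk ?N F < rk ?N (F \<union> {x})"
      using FG x by (auto simp: ideal_preimage_def)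
  qed
  moreover have "int (matroid_rank ?N) - int (matroid_rank M) \<in> {0, 1}"
    by (simp add: ideal_preimage_def matroid_rank_def)
  ultimately show ?thesis
    using M N g by (simp add: elementary_preimage_def elementary_quotient_map_def quotient_map_def)
qed

lemma preimage_ideal_inverse:
  assumes "modular_ideal M I"
  shows "preimage_ideal M (ideal_preimage M I) = I"
  using modular_ideal_subset[OF assms]
  by (auto simp: preimage_ideal_def ideal_preimage_def split: if_splits)

text \<open>Let \<open>F\<close> be the closure of \<open>X\<close> in \<open>M\<close>. It is a
  flat of \<open>N\<close> that misses \<open>a\<close>, so \<open>a\<close> raises the
  \<open>N\<close>-rank of \<open>F\<close>, and by diminishing increments also that of
  \<open>X\<close>.\<close>

lemma quotient_map_insert:
  assumes NM: "quotient_map N M" and X: "X \<subseteq> ground M" "a \<in> ground M"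
    and lt: "rk M X < rk M (insert a X)"
  shows "rk N X < rk N (insert a X)"
proof -
  have M: "is_matroid M" and N: "is_matroid N" and g: "ground N = ground M"
    using NM by (auto simp: quotient_map_def)
  define F where "F = {y \<in> ground M. rk M (insert y X) = rk M X}"
  have F: "X \<subseteq> F" "flat M F" using flat_closure[OF M X(1)] by (auto simp: F_def)
  have "flat N F" using NM F(2) by (simp add: quotient_map_def)
  moreover have "a \<notin> F" using lt by (simp add: F_def)
  ultimately have "rk N F < rk N (insert a F)" "F \<subseteq> ground N"
    using X(2) g by (auto simp: flat_def)
  then show ?thesis using rk_insert_antimono[OF N F(1)] X(2) g by simp
qed

text \<open>Adding one element raises \<open>rk M\<close> by at most 1, and whenever it does, it
  raises \<open>rk N\<close> too, so \<open>rk N - rk M\<close> cannot decrease. The form with sums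
  avoids truncated subtraction.\<close>

lemma quotient_map_difference_mono:
  assumes NM: "quotient_map N M" and XY: "X \<subseteq> Y" "Y \<subseteq> ground M"
  shows "rk M Y + rk N X \<le> rk N Y + rk M X"
proof -
  have M: "is_matroid M" and N: "is_matroid N" and g: "ground N = ground M"
    using NM by (auto simp: quotient_map_def)
  have "finite (Y - X)" using XY finite_ground[OF M] finite_subset by blast
  moreover have "rk M (X \<union> Z) + rk N X \<le> rk N (X \<union> Z) + rk M X"
    if "finite Z" "Z \<subseteq> ground M" for Z
    using that
  proof (induction Z)
    case (insert a Z)
    have sub: "X \<union> Z \<subseteq> ground M" "a \<in> ground M" using insert.prems XY by auto
    have "rk M (insert a (X \<union> Z)) \<le> Suc (rk M (X \<union> Z))" by (rule rk_insert_le[OF M sub])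
    moreover have "rk N (X \<union> Z) \<le> rk N (insert a (X \<union> Z))"
      using sub g by (intro rk_mono[OF N]) auto
    moreover have "rk N (X \<union> Z) < rk N (insert a (X \<union> Z))"
      if "rk M (X \<union> Z) < rk M (insert a (X \<union> Z))"
      by (rule quotient_map_insert[OF NM sub that])
    ultimately have "rk M (insert a (X \<union> Z)) + rk N X \<le> rk N (insert a (X \<union> Z)) + rk M X"
      using insert by (cases "rk M (X \<union> Z) < rk M (insert a (X \<union> Z))") auto
    then show ?case by simp
  qed simp
  ultimately have "rk M (X \<union> (Y - X)) + rk N X \<le> rk N (X \<union> (Y - X)) + rk M X"
    using XY by blast
  moreover have "X \<union> (Y - X) = Y" using XY(1) by auto
  ultimately show ?thesis by simp
qed

lemma elementary_preimageD:
  assumes "elementary_preimage M N"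
  shows "is_matroid M" "is_matroid N" "ground N = ground M" "quotient_map N M"
    and "rk N (ground M) \<le> Suc (rk M (ground M))"
  using assms
  by (auto simp: elementary_preimage_def elementary_quotient_map_def quotient_map_def
      matroid_rank_def)

text \<open>The monotone difference \<open>rk N - rk M\<close> is 0 at \<open>{}\<close> and at most
  1 at the ground set.\<close>

lemma elementary_preimage_rk_bounds:
  assumes MN: "elementary_preimage M N" and X: "X \<subseteq> ground M"
  shows "rk M X \<le> rk N X" "rk N X \<le> Suc (rk M X)"
proof -
  note * = elementary_preimageD[OF MN]
  show "rk M X \<le> rk N X"
    using quotient_map_difference_mono[OF *(4), of "{}" X] X rk_empty[OF *(1)] rk_empty[OF *(2)]
    by simp
  show "rk N X \<le> Suc (rk M X)"
    using quotient_map_difference_mono[OF *(4) X] *(5) by simp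
qed

text \<open>The zero set of a monotone nonnegative difference is closed under subsets. A non-loop
  has rank 1 in both matroids. For a modular pair in the zero set, submodularity of \<open>N\<close>
  bounds the sum of the \<open>N\<close>-ranks of union and intersection by the sum of their
  \<open>M\<close>-ranks; as \<open>rk M \<le> rk N\<close>, equality holds for both.\<close>

lemma modular_ideal_preimage_ideal:
  assumes MN: "elementary_preimage M N"
  shows "modular_ideal M (preimage_ideal M N)"
proof -
  note * = elementary_preimageD[OF MN]
  note bounds = elementary_preimage_rk_bounds[OF MN]
  have "{} \<in> preimage_ideal M N"
    using rk_empty[OF *(1)] rk_empty[OF *(2)] by (simp add: preimage_ideal_def)
  moreover have "Y \<in> preimage_ideal M N" if "X \<in> preimage_ideal M N" "Y \<subseteq> X" for X Y
    using that quotient_map_difference_mono[OF *(4), of Y X] bounds(1)[of Y]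
    by (auto simp: preimage_ideal_def)
  moreover have "{a} \<in> preimage_ideal M N" if "a \<in> ground M" "\<not> loop M a" for a
    using that bounds(1)[of "{a}"] rk_le_card[OF *(2), of "{a}"] *(3)
    by (simp add: preimage_ideal_def loop_def)
  moreover have "X \<union> Y \<in> preimage_ideal M N"
    if "X \<in> preimage_ideal M N" "Y \<in> preimage_ideal M N" "modular_pair M X Y" for X Y
  proof -
    have XY: "X \<subseteq> ground M" "Y \<subseteq> ground M" "X \<inter> Y \<subseteq> ground M"
      using that by (auto simp: preimage_ideal_def)
    then show ?thesis
      using that rk_submodular[OF *(2), of X Y] bounds(1)[of "X \<union> Y"] bounds(1)[of "X \<inter> Y"] *(3)
      by (auto simp: preimage_ideal_def modular_pair_def)
  qed
  moreover have "preimage_ideal M N \<subseteq> Pow (ground M)" by (auto simp: preimage_ideal_def)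
  ultimately show ?thesis
    unfolding modular_ideal_def simplicial_complex_def by blast
qed

text \<open>A difference with values in \<open>{0, 1}\<close> is determined by its zero set.\<close>

lemma ideal_preimage_inverse:
  assumes MN: "elementary_preimage M N"
  shows "ideal_preimage M (preimage_ideal M N) = N"
proof (rule matroid_eqI)
  note * = elementary_preimageD[OF MN]
  show "is_matroid (ideal_preimage M (preimage_ideal M N))"
    by (rule is_matroid_ideal_preimage[OF *(1) modular_ideal_preimage_ideal[OF MN]])
  show "is_matroid N" by (rule *(2))
  show "ground (ideal_preimage M (preimage_ideal M N)) = ground N"
    using *(3) by (simp add: ideal_preimage_def)
  fix X assume "X \<subseteq> ground (ideal_preimage M (preimage_ideal M N))"
  then have "X \<subseteq> ground M" by (simp add: ideal_preimage_def)
  then show "rk (ideal_preimage M (preimage_ideal M N)) X = rk N X"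
    using elementary_preimage_rk_bounds[OF MN]
    by (simp add: ideal_preimage_def preimage_ideal_def order_antisym not_less_eq_eq)
      (metis le_antisym not_less_eq_eq)
qed

lemma bij_betw_MatId_MatPreim:
  "bij_betw (\<lambda>(M, I). (M, ideal_preimage M I)) (MatId S) (MatPreim S)"
proof (rule bij_betw_byWitness[where f' = "\<lambda>(M, N). (M, preimage_ideal M N)"])
  show "(\<lambda>(M, I). (M, ideal_preimage M I)) ` MatId S \<subseteq> MatPreim S"
    by (auto simp: MatId_def MatPreim_def elementary_preimage_ideal_preimage)
  show "(\<lambda>(M, N). (M, preimage_ideal M N)) ` MatPreim S \<subseteq> MatId S"
    by (auto simp: MatId_def MatPreim_def modular_ideal_preimage_ideal)
qed (auto simp: MatId_def MatPreim_def preimage_ideal_inverse ideal_preimage_inverse)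

section \<open>Elementary preimages and coextensions\<close>

text \<open>Both branches are forced: sets avoiding \<open>p\<close> keep their rank under deletion,
  and contraction subtracts \<open>rk N {p} = 1\<close> of the coextension, which \<open>Suc\<close>
  puts back.\<close>

definition preimage_coextension :: "'a \<Rightarrow> 'a matroid \<Rightarrow> 'a matroid \<Rightarrow> 'a matroid" where
  "preimage_coextension p M N = Matroid (insert p (ground M))
    (\<lambda>X\<in>Pow (insert p (ground M)). if p \<in> X then Suc (rk M (X - {p})) else rk N X)"

section \<open>Deletion and contraction as matroids\<close>

definition delete :: "'a matroid \<Rightarrow> 'a \<Rightarrow> 'a matroid" where
  "delete M p = Matroid (ground M - {p}) (restrict (rk M) (Pow (ground M - {p})))"

lemma is_matroid_delete:
  assumes "is_matroid M"
  shows "is_matroid (delete M p)"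
  unfolding delete_def
proof (rule is_matroidI)
  show "finite (ground M - {p})" using finite_ground[OF assms] by simp
qed (auto intro: rk_le_card[OF assms] rk_mono[OF assms] rk_submodular[OF assms])

lemma is_matroid_contract:
  assumes M: "is_matroid M" and p: "p \<in> ground M"
  shows "is_matroid (contract M p)"
  unfolding contract_def
proof (rule is_matroidI)
  show "finite (ground M - {p})" using finite_ground[OF M] by simp
next
  fix X assume X: "X \<subseteq> ground M - {p}"
  then have "rk M (X \<union> {p}) + rk M (X \<inter> {p}) \<le> rk M X + rk M {p}" "rk M X \<le> card X"
    using p by (blast intro: rk_submodular[OF M] rk_le_card[OF M])+
  then show "rk M (X \<union> {p}) - rk M {p} \<le> card X" by simp
next
  fix X Y assume "X \<subseteq> Y" "Y \<subseteq> ground M - {p}"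
  then have "rk M (X \<union> {p}) \<le> rk M (Y \<union> {p})"
    using p by (intro rk_mono[OF M]) auto
  then show "rk M (X \<union> {p}) - rk M {p} \<le> rk M (Y \<union> {p}) - rk M {p}" by simp
next
  fix X Y assume XY: "X \<subseteq> ground M - {p}" "Y \<subseteq> ground M - {p}"
  \<comment> \<open>All four truncated subtractions have to be exact before submodularity can be
    transferred.\<close>
  have "rk M {p} \<le> rk M (Z \<union> {p})" if "Z \<subseteq> ground M - {p}" for Z
    using that p by (intro rk_mono[OF M]) auto
  from this[OF XY(1)] this[OF XY(2)] this[of "X \<union> Y"] this[of "X \<inter> Y"]
  have "rk M {p} \<le> rk M (X \<union> {p})" "rk M {p} \<le> rk M (Y \<union> {p})"
    "rk M {p} \<le> rk M (X \<union> Y \<union> {p})" "rk M {p} \<le> rk M (X \<inter> Y \<union> {p})"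
    using XY by auto
  moreover have "(X \<union> {p}) \<union> (Y \<union> {p}) = X \<union> Y \<union> {p}" "(X \<union> {p}) \<inter> (Y \<union> {p}) = X \<inter> Y \<union> {p}"
    by auto
  then have "rk M (X \<union> Y \<union> {p}) + rk M (X \<inter> Y \<union> {p}) \<le> rk M (X \<union> {p}) + rk M (Y \<union> {p})"
    using rk_submodular[OF M, of "X \<union> {p}" "Y \<union> {p}"] XY p by auto
  ultimately show "rk M (X \<union> Y \<union> {p}) - rk M {p} + (rk M (X \<inter> Y \<union> {p}) - rk M {p})
      \<le> rk M (X \<union> {p}) - rk M {p} + (rk M (Y \<union> {p}) - rk M {p})"
    by linarith
qed

text \<open>If both sets contain \<open>p\<close>, or neither does, the inequalities are those of
  \<open>M\<close> or of \<open>N\<close>. Otherwise monotonicity uses that \<open>rk N\<close>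
  exceeds \<open>rk M\<close> by at most 1, and submodularity uses that the difference is
  monotone.\<close>

lemma is_matroid_preimage_coextension:
  assumes MN: "elementary_preimage M N" and p: "p \<notin> ground M"
  shows "is_matroid (preimage_coextension p M N)"
  unfolding preimage_coextension_def
proof (rule is_matroidI)
  note * = elementary_preimageD[OF MN]
  note bounds = elementary_preimage_rk_bounds[OF MN]
  let ?r = "\<lambda>X. if p \<in> X then Suc (rk M (X - {p})) else rk N X"
  show fin: "finite (insert p (ground M))" using finite_ground[OF *(1)] by simp
  {
    fix X assume X: "X \<subseteq> insert p (ground M)"
    then have "finite X" using fin finite_subset by blast
    show "?r X \<le> card X"
    proof (cases "p \<in> X")
      case True
      have "rk M (X - {p}) \<le> card (X - {p})" using X by (intro rk_le_card[OF *(1)]) auto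
      then show ?thesis using True \<open>finite X\<close> by (simp only: if_True card.remove[of X p] Suc_le_mono)
    next
      case False
      then show ?thesis using X *(3) by (auto intro: rk_le_card[OF *(2)])
    qed
  next
    fix X Y assume XY: "X \<subseteq> Y" "Y \<subseteq> insert p (ground M)"
    show "?r X \<le> ?r Y"
    proof (cases "p \<in> X")
      case True
      then show ?thesis using XY rk_mono[OF *(1), of "X - {p}" "Y - {p}"] by auto
    next
      case False
      then have "X \<subseteq> Y - {p}" "Y - {p} \<subseteq> ground M" using XY by auto
      then have "rk N X \<le> rk N (Y - {p})" "rk N (Y - {p}) \<le> Suc (rk M (Y - {p}))"
        using rk_mono[OF *(2)] *(3) bounds(2) by auto
      then show ?thesis using False by (cases "p \<in> Y") auto
    qed
  next
    have mixed: "?r (X \<union> Y) + ?r (X \<inter> Y) \<le> ?r X + ?r Y"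
      if XY: "X \<subseteq> insert p (ground M)" "Y \<subseteq> insert p (ground M)" and pX: "p \<notin> X" "p \<in> Y" for X Y
    proof -
      have sub: "X \<subseteq> ground M" "Y - {p} \<subseteq> ground M" using XY pX by auto
      \<comment> \<open>This trades the \<open>N\<close>-ranks of \<open>X\<close> and
        \<open>X \<inter> Y\<close> for their \<open>M\<close>-ranks, so that submodularity of
        \<open>M\<close> for \<open>X\<close> and \<open>Y - {p}\<close> finishes the case.\<close>
      have "rk M X + rk N (X \<inter> Y) \<le> rk N X + rk M (X \<inter> Y)"
        using sub by (intro quotient_map_difference_mono[OF *(4)]) auto
      moreover have "X \<union> (Y - {p}) = X \<union> Y - {p}" "X \<inter> (Y - {p}) = X \<inter> Y" using pX by auto
      then have "rk M (X \<union> Y - {p}) + rk M (X \<inter> Y) \<le> rk M X + rk M (Y - {p})"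
        using rk_submodular[OF *(1) sub] by simp
      ultimately show ?thesis using pX by simp
    qed
    fix X Y assume XY: "X \<subseteq> insert p (ground M)" "Y \<subseteq> insert p (ground M)"
    consider "p \<in> X" "p \<in> Y" | "p \<notin> X" "p \<notin> Y" | "p \<notin> X" "p \<in> Y" | "p \<in> X" "p \<notin> Y" by blast
    then show "?r (X \<union> Y) + ?r (X \<inter> Y) \<le> ?r X + ?r Y"
    proof cases
      case 1
      have "(X - {p}) \<union> (Y - {p}) = X \<union> Y - {p}" "(X - {p}) \<inter> (Y - {p}) = X \<inter> Y - {p}" by auto
      then have "rk M (X \<union> Y - {p}) + rk M (X \<inter> Y - {p}) \<le> rk M (X - {p}) + rk M (Y - {p})"
        using rk_submodular[OF *(1), of "X - {p}" "Y - {p}"] XY by auto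
      then show ?thesis using 1 by simp
    next
      case 2
      then have "X \<subseteq> ground N" "Y \<subseteq> ground N" using XY *(3) by auto
      from rk_submodular[OF *(2) this] show ?thesis using 2 by simp
    next
      case 3
      then show ?thesis by (rule mixed[OF XY])
    next
      case 4
      from mixed[OF XY(2,1) this(2,1)] show ?thesis by (simp only: Un_commute Int_commute add.commute)
    qed
  }
qed

section \<open>The two minors of the constructed coextension\<close>

lemma ground_contract: "ground (contract M p) = ground M - {p}"
  by (simp add: contract_def)

lemma ground_delete: "ground (delete M p) = ground M - {p}"
  by (simp add: delete_def)

lemma rk_contract:
  "X \<subseteq> ground M - {p} \<Longrightarrow> rk (contract M p) X = rk M (insert p X) - rk M {p}"
  by (simp add: contract_def)

lemma contract_preimage_coextension:
  assumes MN: "elementary_preimage M N" and p: "p \<notin> ground M"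
  shows "contract (preimage_coextension p M N) p = M"
proof (rule matroid_eqI)
  note * = elementary_preimageD[OF MN]
  show "is_matroid (contract (preimage_coextension p M N) p)"
    using is_matroid_preimage_coextension[OF assms]
    by (rule is_matroid_contract) (simp add: preimage_coextension_def)
  show "is_matroid M" by (rule *(1))
  show g: "ground (contract (preimage_coextension p M N) p) = ground M"
    using p by (auto simp: ground_contract preimage_coextension_def)
  fix X assume "X \<subseteq> ground (contract (preimage_coextension p M N) p)"
  then have "X \<subseteq> ground M" "p \<notin> X" using g p by auto
  then show "rk (contract (preimage_coextension p M N) p) X = rk M X"
    using p rk_empty[OF *(1)]
    by (subst rk_contract) (auto simp: preimage_coextension_def)
qed

lemma delete_preimage_coextension:
  assumes MN: "elementary_preimage M N" and p: "p \<notin> ground M"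
  shows "delete (preimage_coextension p M N) p = N"
proof (rule matroid_eqI)
  note * = elementary_preimageD[OF MN]
  show "is_matroid (delete (preimage_coextension p M N) p)"
    by (rule is_matroid_delete[OF is_matroid_preimage_coextension[OF assms]])
  show "is_matroid N" by (rule *(2))
  show g: "ground (delete (preimage_coextension p M N) p) = ground N"
    using p *(3) by (auto simp: ground_delete preimage_coextension_def)
  fix X assume "X \<subseteq> ground (delete (preimage_coextension p M N) p)"
  then have "X \<subseteq> ground M" "p \<notin> X" using g p *(3) by auto
  then show "rk (delete (preimage_coextension p M N) p) X = rk N X"
    by (auto simp: delete_def preimage_coextension_def)
qed

lemma rank_increasing_preimage_coextension:
  assumes MN: "elementary_preimage M N" and p: "p \<notin> ground M"
  shows "rank_increasing_coextension M p (preimage_coextension p M N)"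
  unfolding rank_increasing_coextension_def single_element_coextension_def
    contract_preimage_coextension[OF assms]
  using p is_matroid_preimage_coextension[OF assms]
  by (simp add: matroid_rank_def preimage_coextension_def)

section \<open>Recovering the preimage from a coextension\<close>

lemma not_loop_iff:
  assumes "is_matroid N" "p \<in> ground N"
  shows "\<not> loop N p \<longleftrightarrow> rk N {p} = 1"
  using rk_le_card[OF assms(1), of "{p}"] assms(2) by (auto simp: loop_def)

lemma matroid_rank_contract:
  assumes "is_matroid N" "p \<in> ground N"
  shows "matroid_rank (contract N p) + rk N {p} = matroid_rank N"
  using rk_mono[OF assms(1), of "{p}" "ground N"] assms(2)
  by (simp add: matroid_rank_def ground_contract rk_contract insert_absorb)

text \<open>Contracting \<open>p\<close> lowers the rank by exactly \<open>rk N {p}\<close>, so the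
  increase is strict precisely when \<open>p\<close> is not a loop.\<close>

lemma rank_increasing_coextension_iff:
  "rank_increasing_coextension M p N \<longleftrightarrow>
    p \<notin> ground M \<and> is_matroid N \<and> ground N = insert p (ground M) \<and> M = contract N p \<and>
    \<not> loop N p"
proof -
  have "matroid_rank N > matroid_rank (contract N p) \<longleftrightarrow> \<not> loop N p"
    if "is_matroid N" "p \<in> ground N"
    using matroid_rank_contract[OF that] not_loop_iff[OF that] rk_le_card[of N "{p}"] that by auto
  then show ?thesis
    unfolding rank_increasing_coextension_def single_element_coextension_def by auto
qed

text \<open>If \<open>x\<close> raises the rank of \<open>F\<close> in the contraction, it raises
  \<open>rk N\<close> of \<open>insert p F\<close>, hence of \<open>F\<close> by diminishing
  increments. Contraction lowers the total rank by 1 and deletion by 0 or 1, which leaves a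
  difference of 0 or 1.\<close>

lemma elementary_preimage_contract_delete:
  assumes N: "is_matroid N" and p: "p \<in> ground N" "\<not> loop N p"
  shows "elementary_preimage (contract N p) (delete N p)"
proof -
  let ?G = "ground N - {p}"
  have rp: "rk N {p} = 1" using not_loop_iff[OF N p(1)] p(2) by simp
  have "flat (delete N p) F" if F: "flat (contract N p) F" for F
    unfolding flat_def ground_delete
  proof (intro conjI ballI)
    show FG: "F \<subseteq> ?G" using F by (simp add: flat_def ground_contract)
    fix x assume x: "x \<in> ?G - F"
    then have "rk (contract N p) F < rk (contract N p) (insert x F)"
      using F by (simp add: flat_def ground_contract)
    then have "rk N (insert p F) < rk N (insert x (insert p F))"
      using FG x by (simp add: rk_contract insert_commute)
    then have "rk N F < rk N (insert x F)"
      using rk_insert_antimono[OF N, of F "insert p F" x] FG x p by auto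
    then show "rk (delete N p) F < rk (delete N p) (F \<union> {x})"
      using FG x by (simp add: delete_def)
  qed
  moreover have "int (matroid_rank (delete N p)) - int (matroid_rank (contract N p)) \<in> {0, 1}"
  proof -
    have "insert p ?G = ground N" using p(1) by auto
    then have "rk N ?G \<le> matroid_rank N" "matroid_rank N \<le> Suc (rk N ?G)"
      using rk_mono[OF N, of ?G "ground N"] rk_insert_le[OF N, of ?G p] p(1)
      by (auto simp: matroid_rank_def)
    moreover have "matroid_rank (delete N p) = rk N ?G"
      by (simp add: matroid_rank_def delete_def)
    ultimately show ?thesis using matroid_rank_contract[OF N p(1)] rp by auto
  qed
  ultimately show ?thesis
    using is_matroid_delete[OF N] is_matroid_contract[OF N p(1)]
    by (simp add: elementary_preimage_def elementary_quotient_map_def quotient_map_def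
        ground_delete ground_contract)
qed

lemma preimage_coextension_inverse:
  assumes N: "is_matroid N" and p: "p \<in> ground N" "\<not> loop N p"
  shows "preimage_coextension p (contract N p) (delete N p) = N"
proof (rule matroid_eqI)
  note pre = elementary_preimage_contract_delete[OF assms]
  show "is_matroid (preimage_coextension p (contract N p) (delete N p))"
    by (rule is_matroid_preimage_coextension[OF pre]) (simp add: ground_contract)
  show "is_matroid N" by (rule N)
  show g: "ground (preimage_coextension p (contract N p) (delete N p)) = ground N"
    using p(1) by (auto simp: preimage_coextension_def ground_contract)
  fix X assume "X \<subseteq> ground (preimage_coextension p (contract N p) (delete N p))"
  then have X: "X \<subseteq> ground N" using g by simp
  have rp: "rk N {p} = 1" using not_loop_iff[OF N p(1)] p(2) by simp
  show "rk (preimage_coextension p (contract N p) (delete N p)) X = rk N X"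
  proof (cases "p \<in> X")
    case True
    \<comment> \<open>Makes the subtraction in the contraction exact, so that \<open>Suc\<close>
      restores \<open>rk N X\<close>.\<close>
    then have "rk N {p} \<le> rk N X" using X by (intro rk_mono[OF N]) auto
    moreover have "rk (contract N p) (X - {p}) = rk N X - rk N {p}"
      using X True by (subst rk_contract) (auto simp: insert_absorb)
    moreover have "X \<subseteq> insert p (ground N - {p})" using X by auto
    ultimately show ?thesis
      using True rp by (simp add: preimage_coextension_def ground_contract)
  next
    case False
    then have "X \<subseteq> ground N - {p}" using X by auto
    moreover from this have "X \<subseteq> insert p (ground N - {p})" by auto
    ultimately show ?thesis
      using False by (simp add: preimage_coextension_def ground_contract delete_def)
  qed
qed

lemma bij_betw_MatPreim_MatCoext:
  assumes "p \<notin> S"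
  shows "bij_betw (\<lambda>(M, N). (M, preimage_coextension p M N)) (MatPreim S) (MatCoext S p)"
proof (rule bij_betw_byWitness[where f' = "\<lambda>(M, N). (M, delete N p)"])
  show "\<forall>P\<in>MatPreim S. (\<lambda>(M, N). (M, delete N p)) ((\<lambda>(M, N). (M, preimage_coextension p M N)) P) = P"
    using assms by (auto simp: MatPreim_def delete_preimage_coextension)
  show "\<forall>P\<in>MatCoext S p. (\<lambda>(M, N). (M, preimage_coextension p M N)) ((\<lambda>(M, N). (M, delete N p)) P) = P"
    by (auto simp: MatCoext_def rank_increasing_coextension_iff preimage_coextension_inverse)
  show "(\<lambda>(M, N). (M, preimage_coextension p M N)) ` MatPreim S \<subseteq> MatCoext S p"
    using assms by (auto simp: MatPreim_def MatCoext_def rank_increasing_preimage_coextension)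
  show "(\<lambda>(M, N). (M, delete N p)) ` MatCoext S p \<subseteq> MatPreim S"
    by (auto simp: MatPreim_def MatCoext_def rank_increasing_coextension_iff
        elementary_preimage_contract_delete)
qed

text \<open>The forgotten first component is recovered as \<open>contract N p\<close>, and the
  remaining condition on \<open>N\<close> is that \<open>p\<close> is not a loop.\<close>

lemma bij_betw_MatCoext_Pointedmat:
  assumes "p \<notin> S"
  shows "bij_betw (\<lambda>(M, N). (N, p)) (MatCoext S p) (Pointedmat S p)"
proof (rule bij_betw_byWitness[where f' = "\<lambda>(N, q). (contract N p, N)"])
  show "(\<lambda>(M, N). (N, p)) ` MatCoext S p \<subseteq> Pointedmat S p"
  proof clarify
    fix M N assume "(M, N) \<in> MatCoext S p"
    then have "is_matroid N" "ground N = insert p S" "\<not> loop N p"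
      unfolding MatCoext_def rank_increasing_coextension_iff by blast+
    then show "(N, p) \<in> Pointedmat S p" by (simp add: Pointedmat_def pointed_matroid_def)
  qed
  show "(\<lambda>(N, q). (contract N p, N)) ` Pointedmat S p \<subseteq> MatCoext S p"
  proof clarify
    fix N q assume "(N, q) \<in> Pointedmat S p"
    then have N: "is_matroid N" "ground N = insert p S" "\<not> loop N p"
      by (simp_all add: Pointedmat_def pointed_matroid_def)
    moreover have "insert p S - {p} = S" using assms by simp
    ultimately show "(contract N p, N) \<in> MatCoext S p"
      using assms is_matroid_contract[of N p]
      by (simp add: MatCoext_def rank_increasing_coextension_iff ground_contract)
  qed
qed (simp_all add: MatCoext_def Pointedmat_def rank_increasing_coextension_iff split_beta)

text \<open>Composing the links of this chain and their inverses connects any two of the five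
  sets.\<close>

theorem theorem5p3:
  fixes S :: "'a set" and p :: 'a
  assumes "finite S" and "p \<notin> S"
  shows "(\<exists>f. bij_betw f (Semimat S) (MatId S)) \<and>
    (\<exists>f. bij_betw f (MatId S) (MatPreim S)) \<and>
    (\<exists>f. bij_betw f (MatPreim S) (MatCoext S p)) \<and>
    (\<exists>f. bij_betw f (MatCoext S p) (Pointedmat S p))"
  using bij_betw_Semimat_MatId[of S] bij_betw_MatId_MatPreim[of S]
    bij_betw_MatPreim_MatCoext[OF assms(2)] bij_betw_MatCoext_Pointedmat[OF assms(2)]
  by blast

end
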